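(* Let $\mathbb{F}$ be a finite field with $n=|\mathbb{F}|$ elements and $R=M_2(\mathbb{F})$. Then the Wiener index of $G_{Id}(R)$ is $W(G_{Id}(R))=\frac{1}{2}(n^2+n)(2n^2-1)$ and its Harary index is $H(G_{Id}(R))=\frac{1}{2}(n^2+n)(n^2+3n-2)$.
   Context: For a ring $R$, $G_{Id}(R)$ is the simple graph whose vertices are the nontrivial idempotents of $R$ (idempotents other than $0$ and $1$), with distinct $h,k$ adjacent iff $hk=0$ or $kh=0$. For a connected graph $G$, $d_G(v)=\sum_{u\in V(G)}d(u,v)$ and $d'_G(v)=\sum_{u\in V(G),u\ne v}\frac{1}{d(u,v)}$. The Wiener index is $W(G)=\frac12\sum_{v\in V(G)}d_G(v)$ (the sum of distances over unordered pairs of vertices), and the Harary index is taken as $H(G)=\sum_{v\in V(G)}d'_G(v)$. *)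

theory Defs
  imports "HOL-Library.Cardinality" "Jordan_Normal_Form.Matrix" "Graph_Theory.Graph_Theory"
begin

text \<open>Undirected simple graphs are represented, as usual in \<open>Graph_Theory\<close>, by symmetric loop-free
  pair digraphs.\<close>

definition nontrivial_idempotents :: "('a, 'm) ring_scheme \<Rightarrow> 'a set" where
  "nontrivial_idempotents R =
     {e \<in> carrier R. e \<otimes>\<^bsub>R\<^esub> e = e \<and> e \<noteq> \<zero>\<^bsub>R\<^esub> \<and> e \<noteq> \<one>\<^bsub>R\<^esub>}"

definition idempotent_graph :: "('a, 'm) ring_scheme \<Rightarrow> 'a pair_pre_digraph" where
  "idempotent_graph R =
     \<lparr> pverts = nontrivial_idempotents R,
       parcs = {(h, k). h \<in> nontrivial_idempotents R \<and> k \<in> nontrivial_idempotents R \<and> h \<noteq> k \<and>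
                        (h \<otimes>\<^bsub>R\<^esub> k = \<zero>\<^bsub>R\<^esub> \<or> k \<otimes>\<^bsub>R\<^esub> h = \<zero>\<^bsub>R\<^esub>)} \<rparr>"

text \<open>Distances, and hence the indices below, are extended reals: vertices in different components
  are at distance \<open>\<infinity>\<close> (contributing \<open>1 / \<infinity> = 0\<close> to the Harary index). In a finite
  connected graph all values are finite.\<close>

definition graph_dist :: "'a pair_pre_digraph \<Rightarrow> 'a \<Rightarrow> 'a \<Rightarrow> ereal" where
  "graph_dist G u v = wf_digraph.\<mu> (with_proj G) (\<lambda>_. 1) u v"

definition dist_sum :: "'a pair_pre_digraph \<Rightarrow> 'a \<Rightarrow> ereal" where
  "dist_sum G v = (\<Sum>u\<in>pverts G. graph_dist G u v)"

definition recip_dist_sum :: "'a pair_pre_digraph \<Rightarrow> 'a \<Rightarrow> ereal" where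
  "recip_dist_sum G v = (\<Sum>u\<in>pverts G - {v}. 1 / graph_dist G u v)"

definition wiener_index :: "'a pair_pre_digraph \<Rightarrow> ereal" where
  "wiener_index G = 1 / 2 * (\<Sum>v\<in>pverts G. dist_sum G v)"

text \<open>The Harary index is taken without the factor \<open>1 / 2\<close>, i.e. each unordered pair of vertices
  is counted twice.\<close>

definition harary_index :: "'a pair_pre_digraph \<Rightarrow> ereal" where
  "harary_index G = (\<Sum>v\<in>pverts G. recip_dist_sum G v)"

lemma pair_wf_idempotent_graph: "pair_wf_digraph (idempotent_graph R)"
  by unfold_locales (auto simp: idempotent_graph_def)

lemma pair_graph_idempotent_graph:
  assumes "finite (carrier R)"
  shows "pair_graph (idempotent_graph R)"
proof -
  have fin: "finite (nontrivial_idempotents R)"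
    using assms by (simp add: nontrivial_idempotents_def)
  have "finite (parcs (idempotent_graph R))"
    by (rule finite_subset[OF _ finite_cartesian_product[OF fin fin]])
       (auto simp: idempotent_graph_def)
  moreover have "symmetric (with_proj (idempotent_graph R))"
    by (auto simp: symmetric_conv idempotent_graph_def)
  ultimately show ?thesis
    using fin by unfold_locales (auto simp: idempotent_graph_def)
qed

lemma graph_dist_eq_walk_length:
  assumes "pair_wf_digraph G"
  shows "graph_dist G u v =
           (INF p\<in>{p. pre_digraph.awalk (with_proj G) u p v}. ereal (real (length p)))"
proof -
  interpret pair_wf_digraph G by fact
  have "awalk_cost (\<lambda>_. 1) p = real (length p)" for p :: "('a \<times> 'a) list"
    by (induction p) auto
  then show ?thesis
    by (simp add: graph_dist_def \<mu>_def)
qed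

end

theory Submission
  imports Defs
begin

text \<open>A nontrivial idempotent of \<open>M\<^sub>2(F)\<close> is determined by its image and its kernel, an arbitrary
  pair \<open>(i, k)\<close> of distinct points of the projective line, and \<open>(i, k)\<close> annihilates \<open>(j, l)\<close> from the
  left iff \<open>k = j\<close>. So there are \<open>n\<^sup>2 + n\<close> vertices, each has \<open>2n - 1\<close> neighbours, and two
  nonadjacent vertices \<open>(i, k)\<close>, \<open>(j, l)\<close> have the common neighbour \<open>(k, j)\<close>. Hence the graph is
  regular of diameter at most 2, which determines both indices.\<close>

section \<open>Regular graphs of diameter at most two\<close>

text \<open>A walk of length 0 forces \<open>u = v\<close> and one of length 1 forces an arc, so no
  walk is shorter than claimed. The empty walk, the arc or the walk through \<open>w\<close> attains
  the infimum.\<close>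

lemma graph_dist_diameter_two:
  assumes "pair_wf_digraph G" and u: "u \<in> pverts G" and v: "v \<in> pverts G"
    and common: "\<lbrakk>u \<noteq> v; (u, v) \<notin> parcs G\<rbrakk> \<Longrightarrow> \<exists>w. (u, w) \<in> parcs G \<and> (w, v) \<in> parcs G"
  shows "graph_dist G u v = (if u = v then 0 else if (u, v) \<in> parcs G then 1 else 2)"
proof -
  interpret pair_wf_digraph G by fact
  let ?d = "if u = v then 0 else if (u, v) \<in> parcs G then 1 else 2 :: nat"
  have lower: "?d \<le> length p" if "awalk u p v" for p
  proof (cases p)
    case Nil
    then show ?thesis using that by (simp add: awalk_def)
  next
    case (Cons a q)
    then show ?thesis using that by (cases q) (auto simp: awalk_def)
  qed
  have "\<exists>p. awalk u p v \<and> length p = ?d"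
  proof -
    consider "u = v" | "u \<noteq> v" "(u, v) \<in> parcs G"
      | w where "u \<noteq> v" "(u, v) \<notin> parcs G" "(u, w) \<in> parcs G" "(w, v) \<in> parcs G"
      using common by blast
    then show ?thesis
    proof cases
      case 1
      then have "awalk u [] v" using u by (simp add: awalk_def)
      then show ?thesis using 1 by force
    next
      case 2
      then have "awalk u [(u, v)] v" using u by (simp add: awalk_def)
      then show ?thesis using 2 by force
    next
      case 3
      then have "awalk u [(u, w), (w, v)] v" using u by (simp add: awalk_def)
      then show ?thesis using 3 by force
    qed
  qed
  then obtain p where p: "awalk u p v" "length p = ?d" by blast
  have "graph_dist G u v = ereal (real ?d)"
    unfolding graph_dist_eq_walk_length[OF assms(1)]
  proof (rule antisym)
    show "(INF p\<in>{p. awalk u p v}. ereal (real (length p))) \<le> ereal (real ?d)"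
      by (rule INF_lower2[of p]) (use p in simp_all)
    show "ereal (real ?d) \<le> (INF p\<in>{p. awalk u p v}. ereal (real (length p)))"
      by (rule INF_greatest) (use lower in \<open>simp only: mem_Collect_eq ereal_less_eq of_nat_le_iff\<close>)
  qed
  then show ?thesis by (simp add: zero_ereal_def one_ereal_def numeral_eq_ereal split: if_splits)
qed

text \<open>From each vertex, \<open>k\<close> others are at distance 1 and \<open>N - 1 - k\<close>
  at distance 2. The factor \<open>1 / 2\<close> comes from counting unordered pairs in the Wiener
  index, but from the reciprocal of the distance 2 in the Harary index.\<close>

lemma indices_regular_diameter_two:
  fixes G :: "'a pair_pre_digraph"
  assumes "pair_graph G"
    and deg: "\<And>v. v \<in> pverts G \<Longrightarrow> card {u. (u, v) \<in> parcs G} = k"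
    and common: "\<And>u v. \<lbrakk>u \<in> pverts G; v \<in> pverts G; u \<noteq> v; (u, v) \<notin> parcs G\<rbrakk>
                   \<Longrightarrow> \<exists>w. (u, w) \<in> parcs G \<and> (w, v) \<in> parcs G"
  defines "N \<equiv> real (card (pverts G))"
  shows "wiener_index G = ereal (1 / 2 * N * (2 * (N - 1) - k))"
    and "harary_index G = ereal (1 / 2 * N * ((N - 1) + k))"
proof -
  interpret pair_graph G by fact
  have wf: "pair_wf_digraph G" by unfold_locales
  \<comment> \<open>The weights \<open>x\<close>, \<open>y\<close> will be 1, 2 for distances and 1,
    \<open>1 / 2\<close> for their reciprocals.\<close>
  have split_sum: "(\<Sum>u\<in>pverts G - {v}. if (u, v) \<in> parcs G then x else y) = k * x + (N - 1 - k) * y"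
    if v: "v \<in> pverts G" for v and x y :: real
  proof -
    let ?A = "{u. (u, v) \<in> parcs G}"
    have A: "?A \<subseteq> pverts G - {v}" using in_arcsD1 no_loops[of "(v, v)"] by auto
    then have finA: "finite ?A" using pair_finite_verts by (meson finite_Diff finite_subset)
    have "card (pverts G - {v}) = card (pverts G) - 1" "card (pverts G) \<ge> 1"
      using v pair_finite_verts by (auto simp: Suc_le_eq card_gt_0_iff)
    then have c: "real (card (pverts G - {v})) = N - 1" by (simp add: N_def)
    have "real (card (pverts G - {v} - ?A)) = N - 1 - k"
      using c card_Diff_subset[OF finA A] card_mono[OF _ A] pair_finite_verts deg[OF v] by simp
    moreover have "(pverts G - {v}) \<inter> ?A = ?A" "(pverts G - {v}) \<inter> - ?A = pverts G - {v} - ?A"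
      using A by auto
    ultimately show ?thesis
      using pair_finite_verts deg[OF v] by (simp add: sum.If_cases)
  qed
  have dist: "graph_dist G u v = ereal (if u = v then 0 else if (u, v) \<in> parcs G then 1 else 2)"
    if "u \<in> pverts G" "v \<in> pverts G" for u v
    using graph_dist_diameter_two[OF wf that common[OF that]] by simp
  have "dist_sum G v = ereal (2 * (N - 1) - k)" if v: "v \<in> pverts G" for v
  proof -
    have "dist_sum G v = (\<Sum>u\<in>pverts G - {v}. graph_dist G u v)"
      unfolding dist_sum_def using v pair_finite_verts dist[OF v v]
      by (simp add: sum.remove zero_ereal_def[symmetric])
    also have "\<dots> = (\<Sum>u\<in>pverts G - {v}. ereal (if (u, v) \<in> parcs G then 1 else 2))"
      by (rule sum.cong) (use v dist in auto)
    finally show ?thesis by (simp add: split_sum[OF v])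
  qed
  then show "wiener_index G = ereal (1 / 2 * N * (2 * (N - 1) - k))"
    by (simp add: wiener_index_def N_def one_ereal_def numeral_eq_ereal)
  have "recip_dist_sum G v = ereal (1 / 2 * ((N - 1) + k))" if v: "v \<in> pverts G" for v
  proof -
    have "recip_dist_sum G v = (\<Sum>u\<in>pverts G - {v}. ereal (if (u, v) \<in> parcs G then 1 else 1 / 2))"
      unfolding recip_dist_sum_def
      by (rule sum.cong) (use v dist in \<open>auto simp: one_ereal_def\<close>)
    then show ?thesis by (simp add: split_sum[OF v] field_simps)
  qed
  then show "harary_index G = ereal (1 / 2 * N * ((N - 1) + k))"
    by (simp add: harary_index_def N_def)
qed

section \<open>Idempotents of the ring of 2 by 2 matrices\<close>

definition mat22 :: "'a \<Rightarrow> 'a \<Rightarrow> 'a \<Rightarrow> 'a \<Rightarrow> 'a mat" where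
  "mat22 a b c d = mat 2 2 (\<lambda>(i, j). if i = 0 then if j = 0 then a else b else if j = 0 then c else d)"

lemma mat22_carrier [simp]: "mat22 a b c d \<in> carrier_mat 2 2"
  by (simp add: mat22_def)

lemma mat22_eq_iff [simp]:
  "mat22 a b c d = mat22 a' b' c' d' \<longleftrightarrow> a = a' \<and> b = b' \<and> c = c' \<and> d = d'"
proof
  assume eq: "mat22 a b c d = mat22 a' b' c' d'"
  have "mat22 a b c d $$ (i, j) = mat22 a' b' c' d' $$ (i, j)" for i j by (simp add: eq)
  from this[of 0 0] this[of 0 1] this[of 1 0] this[of 1 1]
  show "a = a' \<and> b = b' \<and> c = c' \<and> d = d'" by (simp add: mat22_def)
qed simp

lemma mat22_exhaust:
  assumes "A \<in> carrier_mat 2 2"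
  obtains a b c d where "A = mat22 a b c d"
proof
  show "A = mat22 (A $$ (0, 0)) (A $$ (0, 1)) (A $$ (1, 0)) (A $$ (1, 1))"
    using assms by (auto simp: mat22_def less_2_cases_iff intro!: eq_matI)
qed

lemma mat22_mult [simp]:
  fixes a b c d :: "'a :: comm_ring_1"
  shows "mat22 a b c d * mat22 a' b' c' d' =
    mat22 (a * a' + b * c') (a * b' + b * d') (c * a' + d * c') (c * b' + d * d')"
  by (rule eq_matI) (auto simp: mat22_def scalar_prod_def less_2_cases_iff numeral_2_eq_2)

lemma zero_mat22: "0\<^sub>m 2 2 = mat22 0 0 0 0"
  by (rule eq_matI) (auto simp: mat22_def)

lemma one_mat22: "1\<^sub>m 2 = mat22 1 0 0 1"
  by (rule eq_matI) (auto simp: mat22_def)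

text \<open>Points of the projective line are modelled by \<open>'a option\<close>: \<open>Some m\<close> is the line spanned by
  \<open>(1, m)\<close> and \<open>None\<close> the line spanned by \<open>(0, 1)\<close>.\<close>

fun line_x :: "'a::field option \<Rightarrow> 'a" where
  "line_x None = 0" | "line_x (Some m) = 1"

fun line_y :: "'a::field option \<Rightarrow> 'a" where
  "line_y None = 1" | "line_y (Some m) = m"

text \<open>The determinant of the two spanning vectors.\<close>

definition cross :: "'a::field option \<Rightarrow> 'a option \<Rightarrow> 'a" where
  "cross i k = line_x i * line_y k - line_y i * line_x k"

lemma cross_eq_0_iff [simp]: "cross i k = 0 \<longleftrightarrow> i = k"
  by (cases i; cases k) (auto simp: cross_def)

text \<open>The projection onto the line \<open>i\<close> along the line \<open>k\<close>.\<close>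

definition projection :: "'a::field option \<times> 'a option \<Rightarrow> 'a mat" where
  "projection = (\<lambda>(i, k). mat22
     (line_x i * line_y k / cross i k) (- line_x i * line_x k / cross i k)
     (line_y i * line_y k / cross i k) (- line_y i * line_x k / cross i k))"

text \<open>\<open>projection (i, k)\<close> is the spanning column of \<open>i\<close> times the
  row \<open>(line_y k, - line_x k)\<close>, divided by \<open>cross i k\<close>. In a product, the
  inner row times the inner column is the scalar \<open>cross j k\<close>.\<close>

lemma projection_mult:
  assumes "i \<noteq> k" "j \<noteq> l"
  defines "s \<equiv> cross j k / (cross i k * cross j l)"
  shows "projection (i, k) * projection (j, l) = mat22
     (s * (line_x i * line_y l)) (- s * (line_x i * line_x l))
     (s * (line_y i * line_y l)) (- s * (line_y i * line_x l))"
proof -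
  \<comment> \<open>Naming the denominators keeps them as nonzero atoms while
    \<open>cross j k\<close> is expanded.\<close>
  define p q where "p = cross i k" and "q = cross j l"
  have "p \<noteq> 0" "q \<noteq> 0" using assms by (simp_all add: p_def q_def)
  then show ?thesis
    by (simp add: projection_def s_def flip: p_def q_def) (simp add: cross_def field_simps)
qed

text \<open>The matrix scaled by \<open>s\<close> is a nonzero column times a nonzero row, so the
  product vanishes only through \<open>cross j k\<close>.\<close>

lemma projection_mult_eq_0_iff:
  assumes "i \<noteq> k" "j \<noteq> l"
  shows "projection (i, k) * projection (j, l) = 0\<^sub>m 2 2 \<longleftrightarrow> k = j"
  unfolding projection_mult[OF assms] using assms
  by (cases i; cases l) (auto simp: zero_mat22)

text \<open>The complementary projection \<open>(k, i)\<close> annihilates \<open>(i, k)\<close>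
  from both sides; if it does the same to \<open>(j, l)\<close>, then \<open>l = k\<close> and
  \<open>i = j\<close>.\<close>

lemma inj_on_projection: "inj_on projection {(i, k). i \<noteq> k}"
proof (rule inj_onI; clarsimp)
  fix i k j l :: "'a option"
  assume ne: "i \<noteq> k" "j \<noteq> l" and eq: "projection (i, k) = projection (j, l)"
  have "projection (i, k) * projection (k, i) = 0\<^sub>m 2 2" "projection (k, i) * projection (i, k) = 0\<^sub>m 2 2"
    using ne by (simp_all add: projection_mult_eq_0_iff)
  then show "i = j \<and> k = l"
    using ne by (simp add: eq projection_mult_eq_0_iff)
qed

lemma projection_nontrivial_idempotent:
  assumes "i \<noteq> k"
  shows "projection (i, k) \<in> nontrivial_idempotents (ring_mat TYPE('a::field) 2 ())"
proof -
  have "projection (i, k) * projection (i, k) = projection (i, k)"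
    unfolding projection_mult[OF assms assms] using assms by (simp add: projection_def)
  moreover have "projection (i, k) \<noteq> 0\<^sub>m 2 2" "projection (i, k) \<noteq> 1\<^sub>m 2"
    using assms by (cases i; cases k; auto simp: projection_def zero_mat22 one_mat22 cross_def)+
  ultimately show ?thesis
    by (simp add: nontrivial_idempotents_def ring_mat_def projection_def)
qed

text \<open>Such a matrix has trace 1 and determinant 0; its image and kernel are then read off from
  its entries.\<close>

lemma nontrivial_idempotent_is_projection:
  fixes A :: "'a::field mat"
  assumes "A \<in> nontrivial_idempotents (ring_mat TYPE('a) 2 ())"
  shows "\<exists>i k. i \<noteq> k \<and> A = projection (i, k)"
proof -
  have A: "A \<in> carrier_mat 2 2" "A * A = A" "A \<noteq> 0\<^sub>m 2 2" "A \<noteq> 1\<^sub>m 2"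
    using assms by (auto simp: nontrivial_idempotents_def ring_mat_def)
  obtain a b c d where abcd: "A = mat22 a b c d" using mat22_exhaust[OF A(1)] .
  have eqs: "a * a + b * c = a" "a * b + b * d = b" "c * a + d * c = c" "c * b + d * d = d"
    using A(2) by (auto simp: abcd)
  have tr: "a + d = 1"
  proof (cases "b = 0 \<and> c = 0")
    case True
    then have "a = 0 \<or> a = 1" "d = 0 \<or> d = 1" using eqs by auto
    then show ?thesis using True A(3,4) by (auto simp: abcd zero_mat22 one_mat22)
  next
    case False
    have "b * (a + d) = b" "c * (a + d) = c" using eqs by (simp_all add: algebra_simps)
    then show ?thesis using False by auto
  qed
  then have d: "d = 1 - a" by (simp add: algebra_simps)
  have det: "b * c = a * (1 - a)" using eqs(1) by (simp add: algebra_simps)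
  have "\<exists>i k. i \<noteq> k \<and> mat22 a b c d = projection (i, k)"
  proof (cases "a = 0")
    case True
    \<comment> \<open>Now \<open>d = 1\<close>: the second column \<open>(b, 1)\<close> spans the
      image, and \<open>(1, - c)\<close> the kernel.\<close>
    let ?i = "if b = 0 then None else Some (1 / b)"
    have "?i \<noteq> Some (- c) \<and> mat22 a b c d = projection (?i, Some (- c))"
      using True det by (auto simp: d projection_def cross_def)
    then show ?thesis by blast
  next
    case False
    \<comment> \<open>The first column \<open>(a, c)\<close> spans the image; the kernel is the line
      on which \<open>a * x + b * y = 0\<close>.\<close>
    let ?k = "if b = 0 then None else Some (- a / b)"
    have "Some (c / a) \<noteq> ?k \<and> mat22 a b c d = projection (Some (c / a), ?k)"
    proof (cases "b = 0")
      case True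
      then show ?thesis using False det by (auto simp: d projection_def cross_def)
    next
      case b: False
      have c: "c = a * (1 - a) / b" using det b by (simp add: field_simps)
      have "cross (Some (c / a)) (Some (- a / b)) = - 1 / b"
        using b False by (simp add: cross_def c field_simps)
      moreover from this have "c / a \<noteq> - a / b"
        using b cross_eq_0_iff[of "Some (c / a)" "Some (- a / b)"] by auto
      ultimately show ?thesis
        using b False by (simp add: d projection_def c)
    qed
    then show ?thesis by blast
  qed
  then show ?thesis by (simp add: abcd)
qed

lemma nontrivial_idempotents_mat22:
  "nontrivial_idempotents (ring_mat TYPE('a::field) 2 ()) = projection ` {(i, k). i \<noteq> k}"
  using projection_nontrivial_idempotent nontrivial_idempotent_is_projection by fast

section \<open>The idempotent graph of the ring of 2 by 2 matrices\<close>

lemma pverts_idempotent_graph_mat22: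
  "pverts (idempotent_graph (ring_mat TYPE('a::field) 2 ())) = projection ` {(i, k). i \<noteq> k}"
  by (simp add: idempotent_graph_def nontrivial_idempotents_mat22)

text \<open>Either equation on the right forces distinct endpoints: together with
  \<open>(i, k) = (j, l)\<close> it would give \<open>i = k\<close>.\<close>

lemma parcs_idempotent_graph_mat22:
  assumes "i \<noteq> k" "j \<noteq> l"
  shows "(projection (i, k), projection (j, l)) \<in> parcs (idempotent_graph (ring_mat TYPE('a::field) 2 ()))
    \<longleftrightarrow> k = j \<or> l = i"
proof -
  have "projection (i, k) = projection (j, l) \<longleftrightarrow> i = j \<and> k = l"
    using inj_on_eq_iff[OF inj_on_projection, of "(i, k)" "(j, l)"] assms by simp
  then show ?thesis
    using assms projection_mult_eq_0_iff[of i k j l] projection_mult_eq_0_iff[of j l i k]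
      projection_nontrivial_idempotent[of i k] projection_nontrivial_idempotent[of j l]
    by (auto simp: idempotent_graph_def ring_mat_def)
qed

lemma card_distinct_pairs:
  "card {(i, k :: 'b::finite). i \<noteq> k} = CARD('b) * (CARD('b) - 1)"
proof -
  have "{(i, k :: 'b). i \<noteq> k} = (SIGMA i:UNIV. - {i})" by auto
  then show ?thesis by (simp add: Compl_eq_Diff_UNIV)
qed

text \<open>The neighbours of \<open>(j, l)\<close> are the pairs ending in \<open>j\<close> and
  those starting with \<open>l\<close>. As the projective line has \<open>CARD('a) + 1\<close>
  points, each family has \<open>CARD('a)\<close> members, and they share only
  \<open>(l, j)\<close>.\<close>

lemma degree_idempotent_graph_mat22:
  fixes v :: "'a::{field, finite} mat"
  assumes "v \<in> pverts (idempotent_graph (ring_mat TYPE('a) 2 ()))"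
  shows "card {u. (u, v) \<in> parcs (idempotent_graph (ring_mat TYPE('a) 2 ()))} = 2 * CARD('a) - 1"
proof -
  let ?G = "idempotent_graph (ring_mat TYPE('a) 2 ())"
  obtain j l where v: "v = projection (j, l)" "j \<noteq> l"
    using assms by (auto simp: pverts_idempotent_graph_mat22)
  let ?I = "(- {j}) \<times> {j} \<union> {l} \<times> (- {l})"
  have "(- {j}) \<times> {j} \<inter> {l} \<times> (- {l}) = {(l, j)}" using v by auto
  then have "card ?I + 1 = 2 * CARD('a)"
    using card_Un_Int[of "(- {j}) \<times> {j}" "{l} \<times> (- {l})"]
    by (simp add: card_cartesian_product Compl_eq_Diff_UNIV)
  moreover have "{u. (u, v) \<in> parcs ?G} = projection ` ?I"
  proof (intro equalityI subsetI; clarify)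
    fix u assume arc: "(u, v) \<in> parcs ?G"
    then have "u \<in> projection ` {(i, k). i \<noteq> k}"
      by (simp add: idempotent_graph_def nontrivial_idempotents_mat22)
    then obtain i k where u: "u = projection (i, k)" "i \<noteq> k" by blast
    then have "(i, k) \<in> ?I"
      using arc v by (auto simp: parcs_idempotent_graph_mat22)
    then show "u \<in> projection ` ?I" unfolding u(1) by (rule imageI)
  next
    fix i k assume "(i, k) \<in> ?I"
    then show "(projection (i, k), v) \<in> parcs ?G"
      using v by (auto simp: parcs_idempotent_graph_mat22)
  qed
  moreover have "card (projection ` ?I) = card ?I"
    by (rule card_image, rule inj_on_subset[OF inj_on_projection]) auto
  ultimately show ?thesis by simp
qed

theorem theorem4p3:
  fixes R :: "'a::{field, finite} mat ring" and n :: real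
  assumes "R = ring_mat TYPE('a) 2 ()" and "n = real CARD('a)"
  shows "wiener_index (idempotent_graph R) = ereal (1 / 2 * (n^2 + n) * (2 * n^2 - 1)) \<and>
         harary_index (idempotent_graph R) = ereal (1 / 2 * (n^2 + n) * (n^2 + 3 * n - 2))"
proof -
  let ?G = "idempotent_graph R"
  have G: "pair_graph ?G"
  proof -
    have "carrier R \<subseteq> (\<lambda>(a, b, c, d). mat22 a b c d) ` UNIV"
    proof
      fix A assume "A \<in> carrier R"
      then obtain a b c d where "A = mat22 a b c d"
        by (auto simp: assms(1) ring_mat_def elim: mat22_exhaust)
      then show "A \<in> (\<lambda>(a, b, c, d). mat22 a b c d) ` UNIV"
        by (intro image_eqI[of _ _ "(a, b, c, d)"]) simp_all
    qed
    then have "finite (carrier R)" by (rule finite_subset) simp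
    then show ?thesis by (rule pair_graph_idempotent_graph)
  qed
  have card: "real (card (pverts ?G)) = n^2 + n"
    by (simp add: assms pverts_idempotent_graph_mat22 card_image[OF inj_on_projection]
        card_distinct_pairs power2_eq_square algebra_simps)
  have deg: "real (2 * CARD('a) - 1) = 2 * n - 1"
    using zero_less_card_finite[where 'a = 'a] by (simp add: assms(2) of_nat_diff Suc_le_eq)
  have common: "\<exists>w. (u, w) \<in> parcs ?G \<and> (w, v) \<in> parcs ?G"
    if u: "u \<in> pverts ?G" and v: "v \<in> pverts ?G" and "u \<noteq> v" and nadj: "(u, v) \<notin> parcs ?G" for u v
  proof -
    obtain i k j l where *: "u = projection (i, k)" "i \<noteq> k" "v = projection (j, l)" "j \<noteq> l"
      using u v by (auto simp: assms(1) pverts_idempotent_graph_mat22)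
    \<comment> \<open>Nonadjacency is what makes the common neighbour \<open>(k, j)\<close> a pair
      of distinct points, hence a vertex.\<close>
    then have "k \<noteq> j" using nadj by (simp add: assms(1) parcs_idempotent_graph_mat22)
    then have "(u, projection (k, j)) \<in> parcs ?G \<and> (projection (k, j), v) \<in> parcs ?G"
      using * by (simp add: assms(1) parcs_idempotent_graph_mat22)
    then show ?thesis ..
  qed
  have reg: "card {u. (u, v) \<in> parcs ?G} = 2 * CARD('a) - 1" if "v \<in> pverts ?G" for v
    using that unfolding assms(1) by (rule degree_idempotent_graph_mat22)
  note indices = indices_regular_diameter_two[OF G reg common, unfolded card deg]
  have "2 * (n^2 + n - 1) - (2 * n - 1) = 2 * n^2 - 1" "n^2 + n - 1 + (2 * n - 1) = n^2 + 3 * n - 2"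
    by simp_all
  then show ?thesis using indices by simp
qed

end
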